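(* The 2-Stage Greedy Cohesive Rule (defined in the context) satisfies fixed-rank-PJR; that is, on every input its output sequence $W$ satisfies fixed-rank-PJR.
   Context: Model. Voters $V=[n]$, a set $C$ of $m$ candidates, rounds $T=\{1,\dots,|T|\}$ with $n,m,|T|\ge1$. In each round $j$ each voter $i$ has a strict complete ranking of $C$; $A_i^j(r)$ is the set of voter $i$'s $r$ most-preferred candidates in round $j$, for $r\in[m]$. A sequence is $W=(w^1,\dots,w^{|T|})\in C^{|T|}$. A group is a nonempty $S\subseteq V$. Fixed-rank-PJR. For a cutoff $r$, a group $S$ agrees in round $j$ if $\bigcap_{i\in S}A_i^j(r)\neq\varnothing$ and is represented in round $j$ if $w^j\in\bigcup_{i\in S}A_i^j(r)$. $W$ satisfies fixed-rank-PJR if, for every $r\in[m]$, every positive integer $\ell$, and every group $S$ that agrees in $k>0$ rounds under cutoff $r$ and satisfies $|S|\ge\ell n/k$, $S$ is represented in at least $\ell$ rounds under cutoff $r$. Notation. $\mathcal K(S,r)=\{j\in T:\bigcap_{i\in S}A_i^j(r)\ne\varnothing\}$ and $\delta(S,r)=\lfloor|\mathcal K(S,r)|\cdot|S|/n\rfloor$. 2-Stage Greedy Cohesive Rule. It sees the whole profile (offline). Initialize $g(S,r)\gets0$ for every $r\in[m]$ and every group $S$. Stage 1: for $r=1,\dots,m$ in increasing order: let $\mathcal V=\{S:\mathcal K(S,r)\ne\varnothing\}$; for each $S\in\mathcal V$ let $\delta^{\mathrm{rem}}(S,r)=\max\{0,\ \delta(S,r)-\sum_{t=1}^{r-1}\sum_{S'\subseteq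 V,\,S'\cap S\ne\varnothing}g(S',t)\}$. While some $S\in\mathcal V$ has $\delta^{\mathrm{rem}}(S,r)>0$: choose $S\in\mathcal V$ maximizing $\delta^{\mathrm{rem}}(S,r)$ (ties broken arbitrarily), set $g(S,r)\gets\delta^{\mathrm{rem}}(S,r)$, and replace $\mathcal V$ by $\{S'\in\mathcal V:S'\cap S=\varnothing\}$. Stage 2: order all pairs $(S,r)$ with $g(S,r)>0$ as $(S_1,r_1),\dots,(S_q,r_q)$ with $|\mathcal K(S_1,r_1)|\le\dots\le|\mathcal K(S_q,r_q)|$ (ties arbitrary). Set $T_{\mathrm{free}}\gets T$. For $h=1,\dots,q$: choose $T_h\subseteq T_{\mathrm{free}}\cap\mathcal K(S_h,r_h)$ with $|T_h|=g(S_h,r_h)$; for each $j\in T_h$ choose $w^j\in\bigcap_{i\in S_h}A_i^j(r_h)$; set $T_{\mathrm{free}}\gets T_{\mathrm{free}}\setminus T_h$. Finally choose $w^j$ arbitrarily for all $j\in T_{\mathrm{free}}$ and output $W$. *)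

theory Defs
  imports Complex_Main "HOL-Library.FuncSet"
begin

text \<open>
  Voters are \<open>1, \<dots>, n\<close> and rounds are \<open>1, \<dots>, |T|\<close>. \<open>ranking E i j\<close> is voter \<open>i\<close>'s ranking of the
  candidates in round \<open>j\<close>, listed from most to least preferred; its values for other indices are
  irrelevant.
\<close>

record 'c election =
  nvoters :: nat
  nrounds :: nat
  cands :: "'c set"
  ranking :: "nat \<Rightarrow> nat \<Rightarrow> 'c list"

definition voters :: "'c election \<Rightarrow> nat set" where
  "voters E = {1..nvoters E}"

definition rounds :: "'c election \<Rightarrow> nat set" where
  "rounds E = {1..nrounds E}"

definition valid_election :: "'c election \<Rightarrow> bool" where
  "valid_election E \<longleftrightarrow>
     nvoters E \<ge> 1 \<and> nrounds E \<ge> 1 \<and> finite (cands E) \<and> card (cands E) \<ge> 1 \<and>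
     (\<forall>i\<in>voters E. \<forall>j\<in>rounds E. distinct (ranking E i j) \<and> set (ranking E i j) = cands E)"

definition top_set :: "'c election \<Rightarrow> nat \<Rightarrow> nat \<Rightarrow> nat \<Rightarrow> 'c set" where
  "top_set E i j r = set (take r (ranking E i j))"

definition sequences :: "'c election \<Rightarrow> (nat \<Rightarrow> 'c) set" where
  "sequences E = (rounds E \<rightarrow>\<^sub>E cands E)"

definition voter_group :: "'c election \<Rightarrow> nat set \<Rightarrow> bool" where
  "voter_group E S \<longleftrightarrow> S \<noteq> {} \<and> S \<subseteq> voters E"

definition agrees :: "'c election \<Rightarrow> nat \<Rightarrow> nat set \<Rightarrow> nat \<Rightarrow> bool" where
  "agrees E r S j \<longleftrightarrow> (\<Inter>i\<in>S. top_set E i j r) \<noteq> {}"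

definition represented :: "'c election \<Rightarrow> (nat \<Rightarrow> 'c) \<Rightarrow> nat \<Rightarrow> nat set \<Rightarrow> nat \<Rightarrow> bool" where
  "represented E W r S j \<longleftrightarrow> W j \<in> (\<Union>i\<in>S. top_set E i j r)"

definition agree_rounds :: "'c election \<Rightarrow> nat set \<Rightarrow> nat \<Rightarrow> nat set" where
  "agree_rounds E S r = {j \<in> rounds E. agrees E r S j}"

definition fixed_rank_PJR :: "'c election \<Rightarrow> (nat \<Rightarrow> 'c) \<Rightarrow> bool" where
  "fixed_rank_PJR E W \<longleftrightarrow>
     (\<forall>r\<in>{1..card (cands E)}. \<forall>l>0. \<forall>S k.
        voter_group E S \<longrightarrow> k > 0 \<longrightarrow> card (agree_rounds E S r) = k \<longrightarrow>
        real (card S) \<ge> real l * real (nvoters E) / real k \<longrightarrow>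
        card {j \<in> rounds E. represented E W r S j} \<ge> l)"

definition delta :: "'c election \<Rightarrow> nat set \<Rightarrow> nat \<Rightarrow> nat" where
  "delta E S r = nat \<lfloor>real (card (agree_rounds E S r)) * real (card S) / real (nvoters E)\<rfloor>"

text \<open>
  The subtraction is on naturals and truncates, which is the maximum with 0. Only values of \<open>g\<close> at
  ranks below \<open>r\<close> are used, so updating \<open>g\<close> at rank \<open>r\<close> does not change the remaining demands at
  rank \<open>r\<close>.
\<close>

definition delta_rem :: "'c election \<Rightarrow> (nat set \<times> nat \<Rightarrow> nat) \<Rightarrow> nat set \<Rightarrow> nat \<Rightarrow> nat" where
  "delta_rem E g S r =
     delta E S r - (\<Sum>t\<in>{1..<r}. \<Sum>S' | S' \<subseteq> voters E \<and> S' \<inter> S \<noteq> {}. g (S', t))"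

definition cohesive :: "'c election \<Rightarrow> nat \<Rightarrow> nat set set" where
  "cohesive E r = {S. voter_group E S \<and> agree_rounds E S r \<noteq> {}}"

definition is_stage2_order ::
  "'c election \<Rightarrow> (nat set \<times> nat \<Rightarrow> nat) \<Rightarrow> (nat set \<times> nat) list \<Rightarrow> bool" where
  "is_stage2_order E g ps \<longleftrightarrow>
     distinct ps \<and>
     set ps = {(S, r). voter_group E S \<and> r \<in> {1..card (cands E)} \<and> g (S, r) > 0} \<and>
     sorted (map (\<lambda>(S, r). card (agree_rounds E S r)) ps)"

text \<open>
  The 2-Stage Greedy Cohesive Rule is a nondeterministic program, given by a small-step semantics in
  which every arbitrary choice is a choice of successor. The configurations are:
  \<^item> \<open>Stage1 r \<V> g\<close>: about to test the while condition at rank \<open>r\<close>;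
  \<^item> \<open>Stage2 g ps F w\<close>: \<open>ps\<close> are the pairs still to be processed, \<open>F\<close> the free rounds, and \<open>w\<close> is
    meaningful exactly on the rounds outside \<open>F\<close>;
  \<^item> \<open>Output W\<close>.
\<close>

datatype 'c config =
    Stage1 nat "nat set set" "nat set \<times> nat \<Rightarrow> nat"
  | Stage2 "nat set \<times> nat \<Rightarrow> nat" "(nat set \<times> nat) list" "nat set" "nat \<Rightarrow> 'c"
  | Output "nat \<Rightarrow> 'c"

definition initial :: "'c election \<Rightarrow> 'c config" where
  "initial E = Stage1 1 (cohesive E 1) (\<lambda>_. 0)"

inductive rule_step :: "'c election \<Rightarrow> 'c config \<Rightarrow> 'c config \<Rightarrow> bool" for E :: "'c election" where
  select:
    "\<lbrakk>S \<in> \<V>; delta_rem E g S r > 0; \<forall>S'\<in>\<V>. delta_rem E g S' r \<le> delta_rem E g S r\<rbrakk>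
     \<Longrightarrow> rule_step E (Stage1 r \<V> g)
           (Stage1 r {S' \<in> \<V>. S' \<inter> S = {}} (g((S, r) := delta_rem E g S r)))"
| next_rank:
    "\<lbrakk>\<not> (\<exists>S\<in>\<V>. delta_rem E g S r > 0); r < card (cands E)\<rbrakk>
     \<Longrightarrow> rule_step E (Stage1 r \<V> g) (Stage1 (r + 1) (cohesive E (r + 1)) g)"
| start_stage2:
    "\<lbrakk>\<not> (\<exists>S\<in>\<V>. delta_rem E g S r > 0); r = card (cands E); is_stage2_order E g ps\<rbrakk>
     \<Longrightarrow> rule_step E (Stage1 r \<V> g) (Stage2 g ps (rounds E) (\<lambda>_. undefined))"
| assign:
    "\<lbrakk>Th \<subseteq> F \<inter> agree_rounds E S r; card Th = g (S, r);
      \<forall>j\<in>Th. v j \<in> (\<Inter>i\<in>S. top_set E i j r)\<rbrakk>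
     \<Longrightarrow> rule_step E (Stage2 g ((S, r) # ps) F w) (Stage2 g ps (F - Th) (override_on w v Th))"
| finish:
    "\<lbrakk>W \<in> sequences E; \<forall>j\<in>rounds E - F. W j = w j\<rbrakk>
     \<Longrightarrow> rule_step E (Stage2 g [] F w) (Output W)"

end

theory Submission
  imports Defs
begin

text \<open>
  Proportionality: when rank \<open>r\<close> is finished, every group \<open>S\<close> with \<open>agree_rounds E S r \<noteq> {}\<close> has
  either no remaining demand or meets a group selected at rank \<open>r\<close> with at least as much remaining
  demand; so the groups meeting \<open>S\<close> at ranks up to \<open>r\<close> receive at least \<open>delta E S r\<close> rounds in
  total, and in each of these rounds \<open>S\<close> is represented.

  The second stage never blocks: take the pairs processed up to \<open>(S, r)\<close> and repeatedly remove one
  of highest rank, together with all pairs whose groups meet it. The removed groups are disjoint,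
  and each accounts for all the rounds of the pairs deleted with it, at most \<open>K\<close> per \<open>n\<close> voters,
  where \<open>K\<close> is the number of rounds in which \<open>S\<close> agrees. Hence at most \<open>K\<close> rounds are needed.
\<close>

section \<open>Allocated rounds\<close>

definition meeting :: "'c election \<Rightarrow> nat set \<Rightarrow> nat set set" where
  "meeting E S = {S'. S' \<subseteq> voters E \<and> S' \<inter> S \<noteq> {}}"

definition allocated :: "'c election \<Rightarrow> (nat set \<times> nat \<Rightarrow> nat) \<Rightarrow> nat set \<Rightarrow> nat set \<Rightarrow> nat" where
  "allocated E g S R = sum g (meeting E S \<times> R)"

text \<open>Formulated with \<open>allocated\<close> instead of \<open>delta_rem\<close>, which
  makes the property monotone in \<open>g\<close>, so that later selections cannot destroy
  it.\<close>

definition covered :: "'c election \<Rightarrow> (nat set \<times> nat \<Rightarrow> nat) \<Rightarrow> nat set \<Rightarrow> nat \<Rightarrow> bool" where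
  "covered E g S r \<longleftrightarrow> delta E S r \<le> allocated E g S {1..r}"

lemma finite_voters [simp]: "finite (voters E)"
  by (simp add: voters_def)

lemma finite_rounds [simp]: "finite (rounds E)"
  by (simp add: rounds_def)

lemma finite_agree_rounds [simp]: "finite (agree_rounds E S r)"
  by (simp add: agree_rounds_def)

lemma finite_meeting [simp]: "finite (meeting E S)"
  by (simp add: meeting_def)

lemma finite_cohesive [simp]: "finite (cohesive E r)"
proof (rule finite_subset)
  show "cohesive E r \<subseteq> Pow (voters E)"
    by (auto simp: cohesive_def voter_group_def)
qed simp

lemma delta_rem_eq: "delta_rem E g S r = delta E S r - allocated E g S {1..<r}"
  unfolding delta_rem_def allocated_def meeting_def
  by (subst sum.swap) (simp add: sum.cartesian_product)

lemma delta_eq_div: "delta E S r = card (agree_rounds E S r) * card S div nvoters E"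
  unfolding delta_def
  by (metis floor_divide_of_nat_eq nat_int of_nat_mult)

text \<open>The remaining demand at rank \<open>t\<close> reads \<open>g\<close> only at ranks below
  \<open>t\<close>, hence never at the changed entry of rank \<open>r\<close>.\<close>

lemma delta_rem_upd:
  assumes "t \<le> r"
  shows "delta_rem E (g((S, r) := x)) S' t = delta_rem E g S' t"
  unfolding delta_rem_eq allocated_def using assms
  by (intro arg_cong2[where f = minus] sum.cong) auto

lemma allocated_mono:
  assumes "\<And>p. g p \<le> g' p"
  shows "allocated E g S R \<le> allocated E g' S R"
  unfolding allocated_def using assms by (rule sum_mono)

lemma covered_mono:
  assumes "covered E g S r" "\<And>p. g p \<le> g' p"
  shows "covered E g' S r"
  using assms allocated_mono[of g g' E S "{1..r}"] by (auto simp: covered_def intro: order_trans)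

lemma allocated_split:
  assumes "1 \<le> r"
  shows "allocated E g S {1..r} = allocated E g S {1..<r} + (\<Sum>S'\<in>meeting E S. g (S', r))"
proof -
  have *: "meeting E S \<times> {1..r} = meeting E S \<times> {1..<r} \<union> meeting E S \<times> {r}"
    using assms by auto
  have "sum g (meeting E S \<times> {r}) = (\<Sum>S'\<in>meeting E S. g (S', r))"
    using sum.cartesian_product[of "\<lambda>S' t. g (S', t)" "{r}" "meeting E S"] by simp
  then show ?thesis
    unfolding allocated_def * by (subst sum.union_disjoint) auto
qed

text \<open>\<open>delta_rem\<close> is what the lower ranks have left open, so a single meeting
  group whose award at rank \<open>r\<close> is at least that large closes the gap.\<close>

lemma covered_if_delta_rem_le:
  assumes "1 \<le> r" "S' \<in> meeting E S" "delta_rem E g S r \<le> g (S', r)"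
  shows "covered E g S r"
proof -
  have "g (S', r) \<le> (\<Sum>S'\<in>meeting E S. g (S', r))"
    using assms(2) by (intro member_le_sum) auto
  then show ?thesis
    using allocated_split[OF assms(1), of E g S] assms(3) by (simp add: covered_def delta_rem_eq)
qed

lemma covered_if_delta_rem_eq_0:
  assumes "1 \<le> r" "delta_rem E g S r = 0"
  shows "covered E g S r"
  using allocated_split[OF assms(1), of E g S] assms(2) by (simp add: covered_def delta_rem_eq)

section \<open>Feasibility of the second stage\<close>

text \<open>The equation for \<open>g (S, t)\<close> refers to the current \<open>g\<close>, not to
  \<open>g\<close> at the moment of selection. This is the same value: \<open>delta_rem\<close> at
  rank \<open>t\<close> reads only lower ranks, which are finished by then.\<close>

definition consistent :: "'c election \<Rightarrow> (nat set \<times> nat \<Rightarrow> nat) \<Rightarrow> bool" where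
  "consistent E g \<longleftrightarrow>
     (\<forall>S t. 0 < g (S, t) \<longrightarrow>
        S \<in> cohesive E t \<and> t \<in> {1..card (cands E)} \<and> g (S, t) = delta_rem E g S t) \<and>
     (\<forall>S S' t. 0 < g (S, t) \<longrightarrow> 0 < g (S', t) \<longrightarrow> S \<noteq> S' \<longrightarrow> S \<inter> S' = {})"

lemma consistent_cohesive: "consistent E g \<Longrightarrow> 0 < g (S, t) \<Longrightarrow> S \<in> cohesive E t"
  and consistent_rank: "consistent E g \<Longrightarrow> 0 < g (S, t) \<Longrightarrow> t \<in> {1..card (cands E)}"
  and consistent_eq: "consistent E g \<Longrightarrow> 0 < g (S, t) \<Longrightarrow> g (S, t) = delta_rem E g S t"
  and consistent_disjoint:
    "consistent E g \<Longrightarrow> 0 < g (S, t) \<Longrightarrow> 0 < g (S', t) \<Longrightarrow> S \<noteq> S' \<Longrightarrow> S \<inter> S' = {}"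
  unfolding consistent_def by blast+

lemma consistent_group: "consistent E g \<Longrightarrow> 0 < g (S, t) \<Longrightarrow> S \<noteq> {} \<and> S \<subseteq> voters E"
  by (drule (1) consistent_cohesive) (simp add: cohesive_def voter_group_def)

text \<open>A pair \<open>(S, r)\<close> of highest rank in \<open>P\<close> pays for all pairs
  whose groups meet \<open>S\<close>. Those of lower rank are counted in the amount that
  \<open>delta_rem\<close> subtracts, so together with \<open>g (S, r)\<close> they use at most
  \<open>delta E S r\<close> rounds. The groups of the other pairs are disjoint from
  \<open>S\<close>, so the bound by numbers of voters is additive.\<close>

lemma sum_allocation_le:
  assumes cons: "consistent E g" and "finite P"
    and "\<And>S t. (S, t) \<in> P \<Longrightarrow> 0 < g (S, t) \<and> card (agree_rounds E S t) \<le> K"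
  shows "nvoters E * sum g P \<le> K * card (\<Union>(fst ` P))"
  using assms(2,3)
proof (induction P rule: finite_psubset_induct)
  case (psubset P)
  show ?case
  proof (cases "P = {}")
    case False
    then have "snd ` P \<noteq> {}" "finite (snd ` P)"
      using psubset.hyps by auto
    then have "Max (snd ` P) \<in> snd ` P" "\<forall>t\<in>snd ` P. t \<le> Max (snd ` P)"
      by simp_all
    then obtain S r where Sr: "(S, r) \<in> P" and max: "\<And>S' t. (S', t) \<in> P \<Longrightarrow> t \<le> r"
      by fastforce
    define Q where "Q = {p \<in> P. fst p \<inter> S = {}}"
    have pos: "0 < g p" if "p \<in> P" for p
      using psubset.prems that by (cases p) auto
    have ne: "S \<noteq> {}" and sub: "fst p \<subseteq> voters E" if "p \<in> P" for p
      using consistent_group[OF cons] pos Sr that by (force, cases p, force)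
    have "Q \<subset> P"
      using Sr ne[OF Sr] unfolding Q_def by force
    then have IH: "nvoters E * sum g Q \<le> K * card (\<Union>(fst ` Q))"
      using psubset.IH[of Q] psubset.prems by blast
    \<comment> \<open>Groups selected at the same rank are disjoint, so at rank \<open>r\<close>
      only \<open>S\<close> itself meets \<open>S\<close>.\<close>
    have "P - Q \<subseteq> insert (S, r) (meeting E S \<times> {1..<r})"
    proof
      fix p assume p: "p \<in> P - Q"
      obtain S' t where [simp]: "p = (S', t)"
        by (cases p)
      have meet: "S' \<inter> S \<noteq> {}" and "t \<le> r"
        using p max by (auto simp: Q_def)
      have "t = r \<Longrightarrow> S' = S"
        using consistent_disjoint[OF cons, of S' r S] pos[of p] pos[OF Sr] p meet by auto
      moreover have "1 \<le> t"
        using consistent_rank[OF cons, of S' t] pos[of p] p by auto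
      ultimately show "p \<in> insert (S, r) (meeting E S \<times> {1..<r})"
        using \<open>t \<le> r\<close> meet sub[of p] p by (auto simp: meeting_def)
    qed
    then have "sum g (P - Q) \<le> sum g (insert (S, r) (meeting E S \<times> {1..<r}))"
      by (intro sum_mono2) auto
    also have "\<dots> = g (S, r) + allocated E g S {1..<r}"
      by (simp add: allocated_def)
    \<comment> \<open>The truncated subtraction in \<open>delta_rem\<close> is exact here because
      \<open>g (S, r)\<close> is positive.\<close>
    also have "\<dots> = delta E S r"
      using consistent_eq[OF cons, of S r] pos[OF Sr] by (simp add: delta_rem_eq)
    finally have "nvoters E * sum g (P - Q) \<le> nvoters E * delta E S r"
      by simp
    also have "\<dots> \<le> card (agree_rounds E S r) * card S"
      by (simp add: delta_eq_div)
    also have "\<dots> \<le> K * card S"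
      using psubset.prems[OF Sr] by simp
    finally have "nvoters E * sum g P \<le> K * (card S + card (\<Union>(fst ` Q)))"
      using IH sum.subset_diff[of Q P g] \<open>Q \<subset> P\<close> psubset.hyps by (simp add: algebra_simps)
    also have "card S + card (\<Union>(fst ` Q)) = card (S \<union> \<Union>(fst ` Q))"
    proof (rule card_Un_disjoint[symmetric])
      show "finite S"
        using sub[OF Sr] finite_subset[OF _ finite_voters] by auto
      show "finite (\<Union>(fst ` Q))"
        using sub by (intro finite_subset[OF _ finite_voters[of E]]) (auto simp: Q_def)
      show "S \<inter> \<Union>(fst ` Q) = {}"
        by (auto simp: Q_def)
    qed
    also have "\<dots> \<le> card (\<Union>(fst ` P))"
    proof (rule card_mono)
      show "finite (\<Union>(fst ` P))"
        using sub by (intro finite_subset[OF _ finite_voters[of E]]) auto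
      show "S \<union> \<Union>(fst ` Q) \<subseteq> \<Union>(fst ` P)"
        using Sr by (force simp: Q_def)
    qed
    finally show ?thesis
      by simp
  qed simp
qed

text \<open>All groups together contain at most \<open>nvoters E\<close> voters, so this factor
  cancels. For \<open>P\<close> the pairs up to a given one in the stage 2 order, \<open>K\<close>
  will be the number of rounds in which the last group agrees.\<close>

lemma sum_allocation_le_agree_rounds:
  assumes "consistent E g" "nvoters E \<ge> 1" "finite P"
    and "\<And>S t. (S, t) \<in> P \<Longrightarrow> 0 < g (S, t) \<and> card (agree_rounds E S t) \<le> K"
  shows "sum g P \<le> K"
proof -
  have "\<Union>(fst ` P) \<subseteq> voters E"
    using assms(4) consistent_group[OF assms(1)] by fastforce
  then have "card (\<Union>(fst ` P)) \<le> nvoters E"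
    using card_mono[OF finite_voters, of _ E] by (simp add: voters_def)
  then have "nvoters E * sum g P \<le> nvoters E * K"
    using sum_allocation_le[OF assms(1,3,4)]
    by (metis (no_types, lifting) le_trans mult.commute mult_le_mono1)
  then show ?thesis
    using assms(2) by simp
qed

section \<open>Proportionality of the served rounds\<close>

text \<open>The map \<open>a\<close> records, for each assigned round, the pair for which it was assigned.\<close>

definition serves ::
  "'c election \<Rightarrow> (nat set \<times> nat \<Rightarrow> nat) \<Rightarrow> (nat set \<times> nat) set \<Rightarrow> nat set \<Rightarrow> (nat \<Rightarrow> 'c) \<Rightarrow>
   (nat \<Rightarrow> nat set \<times> nat) \<Rightarrow> bool" where
  "serves E g D J w a \<longleftrightarrow>
     (\<forall>j\<in>J. a j \<in> D \<and> w j \<in> (\<Inter>i\<in>fst (a j). top_set E i j (snd (a j)))) \<and>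
     (\<forall>p\<in>D. card {j \<in> J. a j = p} = g p)"

lemma serves_card:
  assumes "serves E g D J w a" "finite J" "finite D"
  shows "card J = sum g D"
proof -
  have "card J = (\<Sum>p\<in>D. card {j \<in> J. a j = p})"
    using assms by (subst card_eq_sum, subst sum.group[symmetric, where g = a and T = D])
      (auto simp: serves_def)
  also have "\<dots> = sum g D"
    using assms(1) by (simp add: serves_def)
  finally show ?thesis .
qed

text \<open>Since \<open>Th\<close> avoids \<open>J\<close>, old rounds keep their candidate and
  label; since \<open>(S, r)\<close> is new, the rounds labelled with it are exactly
  \<open>Th\<close>.\<close>

lemma serves_extend:
  assumes "serves E g D J w a" "(S, r) \<notin> D" "Th \<inter> J = {}" "card Th = g (S, r)"
    and "\<forall>j\<in>Th. v j \<in> (\<Inter>i\<in>S. top_set E i j r)"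
  shows "serves E g (insert (S, r) D) (J \<union> Th) (override_on w v Th)
           (override_on a (\<lambda>_. (S, r)) Th)"
proof -
  let ?a = "override_on a (\<lambda>_. (S, r)) Th"
  have "{j \<in> J \<union> Th. ?a j = (S, r)} = Th"
    using assms(1-3) by (auto simp: serves_def override_on_def)
  moreover have "{j \<in> J \<union> Th. ?a j = p} = {j \<in> J. a j = p}" if "p \<in> D" for p
    using assms(2,3) that by (auto simp: override_on_def)
  ultimately show ?thesis
    using assms by (auto simp: serves_def override_on_def)
qed

lemma top_set_mono: "t \<le> r \<Longrightarrow> top_set E i j t \<subseteq> top_set E i j r"
  by (simp add: top_set_def set_take_subset_set_take)

lemma top_set_subset_cands:
  assumes "valid_election E" "i \<in> voters E" "j \<in> rounds E"
  shows "top_set E i j r \<subseteq> cands E"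
  using assms set_take_subset[of r "ranking E i j"] by (auto simp: top_set_def valid_election_def)

definition supp :: "(nat set \<times> nat \<Rightarrow> nat) \<Rightarrow> (nat set \<times> nat) set" where
  "supp g = {p. 0 < g p}"

text \<open>The size condition on \<open>S\<close> gives \<open>l \<le> delta E S r\<close>, and
  coverage bounds this by the rounds served to groups meeting \<open>S\<close> at ranks
  \<open>t \<le> r\<close>. In such a round a voter common to both groups has the chosen candidate
  among the top \<open>t\<close>, hence among the top \<open>r\<close>, so \<open>S\<close> is
  represented.\<close>

lemma fixed_rank_PJR_if_serves:
  assumes valid: "valid_election E"
    and cov: "\<And>t S. t \<in> {1..card (cands E)} \<Longrightarrow> S \<in> cohesive E t \<Longrightarrow> covered E g S t"
    and serves: "serves E g (supp g) J W a" and J: "J \<subseteq> rounds E"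
  shows "fixed_rank_PJR E W"
  unfolding fixed_rank_PJR_def
proof (intro ballI allI impI)
  fix r l S k
  assume r: "r \<in> {1..card (cands E)}" and S: "voter_group E S" and k: "0 < k"
    "card (agree_rounds E S r) = k" and size: "real (card S) \<ge> real l * real (nvoters E) / real k"
  have n: "nvoters E > 0"
    using valid by (simp add: valid_election_def)
  have "real l * real (nvoters E) \<le> real (card S) * real k"
    using size k(1) by (simp add: divide_le_eq)
  then have "l * nvoters E \<le> card (agree_rounds E S r) * card S"
    unfolding k(2) by (metis mult.commute of_nat_le_iff of_nat_mult)
  then have "l \<le> delta E S r"
    using n by (simp add: delta_eq_div less_eq_div_iff_mult_less_eq)
  moreover have "S \<in> cohesive E r"
    using S k by (auto simp: cohesive_def)
  ultimately have "l \<le> allocated E g S {1..r}"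
    using cov r by (force simp: covered_def)
  also have "\<dots> = sum g (meeting E S \<times> {1..r} \<inter> supp g)"
    unfolding allocated_def supp_def by (rule sum.mono_neutral_right) auto
  also have "\<dots> = (\<Sum>p\<in>meeting E S \<times> {1..r} \<inter> supp g. card {j \<in> J. a j = p})"
    using serves by (intro sum.cong) (auto simp: serves_def)
  \<comment> \<open>Each round carries only one label, so no round is counted for two pairs.\<close>
  also have "\<dots> = card (\<Union>p\<in>meeting E S \<times> {1..r} \<inter> supp g. {j \<in> J. a j = p})"
    using finite_subset[OF J] by (subst card_UN_disjoint) auto
  also have "\<dots> \<le> card {j \<in> rounds E. represented E W r S j}"
  proof (rule card_mono)
    show "(\<Union>p\<in>meeting E S \<times> {1..r} \<inter> supp g. {j \<in> J. a j = p})
        \<subseteq> {j \<in> rounds E. represented E W r S j}"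
    proof
      fix j assume "j \<in> (\<Union>p\<in>meeting E S \<times> {1..r} \<inter> supp g. {j \<in> J. a j = p})"
      then obtain S' t where j: "j \<in> J" "a j = (S', t)" and "S' \<in> meeting E S" and t: "t \<le> r"
        by auto
      then obtain i where i: "i \<in> S'" "i \<in> S"
        by (auto simp: meeting_def)
      have "W j \<in> top_set E i j t"
        using serves j i by (force simp: serves_def)
      then show "j \<in> {j \<in> rounds E. represented E W r S j}"
        using top_set_mono[OF t, of E i j] i(2) j(1) J by (auto simp: represented_def)
    qed
  qed simp
  finally show "l \<le> card {j \<in> rounds E. represented E W r S j}" .
qed

section \<open>The invariant\<close>

text \<open>In stage 1, groups still in \<open>\<V>\<close> are disjoint from those selected at rank
  \<open>r\<close>, and groups that have left \<open>\<V>\<close> are covered. In stage 2,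
  \<open>qs\<close> (the processed pairs) and the labelling \<open>a\<close> are not part of the
  configuration and are therefore quantified existentially.\<close>

fun invariant :: "'c election \<Rightarrow> 'c config \<Rightarrow> bool" where
  "invariant E (Stage1 r \<V> g) \<longleftrightarrow>
     r \<in> {1..card (cands E)} \<and> \<V> \<subseteq> cohesive E r \<and> consistent E g \<and>
     (\<forall>S t. 0 < g (S, t) \<longrightarrow> t \<le> r) \<and>
     (\<forall>S\<in>\<V>. \<forall>S'. 0 < g (S', r) \<longrightarrow> S \<inter> S' = {}) \<and>
     (\<forall>t\<in>{1..<r}. \<forall>S\<in>cohesive E t. covered E g S t) \<and>
     (\<forall>S\<in>cohesive E r - \<V>. covered E g S r)"
| "invariant E (Stage2 g ps F w) \<longleftrightarrow>
     consistent E g \<and> (\<forall>t\<in>{1..card (cands E)}. \<forall>S\<in>cohesive E t. covered E g S t) \<and>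
     F \<subseteq> rounds E \<and>
     (\<exists>qs a. is_stage2_order E g (qs @ ps) \<and> serves E g (set qs) (rounds E - F) w a)"
| "invariant E (Output W) \<longleftrightarrow> W \<in> sequences E \<and> fixed_rank_PJR E W"

text \<open>Consistency makes the restrictions to voter groups and to ranks in range
  automatic.\<close>

lemma stage2_order_set:
  assumes "consistent E g" "is_stage2_order E g ps"
  shows "set ps = supp g"
  using assms consistent_group[of E g] consistent_rank[of E g]
  by (force simp: is_stage2_order_def supp_def voter_group_def)

section \<open>Validity of the invariant initially and after each step\<close>

lemma invariant_initial: "valid_election E \<Longrightarrow> invariant E (initial E)"
  by (auto simp: initial_def consistent_def valid_election_def)

text \<open>The groups that now leave \<open>\<V>\<close> meet \<open>S\<close> and demand no more
  than \<open>S\<close>, so the award to \<open>S\<close> covers them; groups that left earlier stay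
  covered by monotonicity.\<close>

lemma invariant_select:
  assumes inv: "invariant E (Stage1 r \<V> g)" and S: "S \<in> \<V>" "0 < delta_rem E g S r"
    and max: "\<forall>S'\<in>\<V>. delta_rem E g S' r \<le> delta_rem E g S r"
  shows "invariant E (Stage1 r {S' \<in> \<V>. S' \<inter> S = {}} (g((S, r) := delta_rem E g S r)))"
proof -
  define g' where "g' = g((S, r) := delta_rem E g S r)"
  have r: "r \<in> {1..card (cands E)}" and V: "\<V> \<subseteq> cohesive E r" and cons: "consistent E g"
    and rank: "\<And>S t. 0 < g (S, t) \<Longrightarrow> t \<le> r"
    and disj: "\<And>S S'. S \<in> \<V> \<Longrightarrow> 0 < g (S', r) \<Longrightarrow> S \<inter> S' = {}"
    and below: "\<And>t S. t \<in> {1..<r} \<Longrightarrow> S \<in> cohesive E t \<Longrightarrow> covered E g S t"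
    and cov: "\<And>S. S \<in> cohesive E r \<Longrightarrow> S \<notin> \<V> \<Longrightarrow> covered E g S r"
    using inv by auto
  have group: "S \<noteq> {}" "S \<subseteq> voters E"
    using S(1) V by (auto simp: cohesive_def voter_group_def)
  \<comment> \<open>Otherwise the nonempty \<open>S\<close> would be disjoint from itself. Hence the
    update only increases \<open>g\<close>.\<close>
  have "g (S, r) = 0"
    using disj[OF S(1), of S] group by auto
  then have le: "g p \<le> g' p" for p
    by (simp add: g'_def)
  have rem: "delta_rem E g' S' t = delta_rem E g S' t" if "t \<le> r" for S' t
    unfolding g'_def using that by (rule delta_rem_upd)
  have rank': "t \<le> r" if "0 < g' (S', t)" for S' t
    using that rank[of S' t] by (auto simp: g'_def split: if_splits)
  have "consistent E g'"
    unfolding consistent_def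
  proof (intro conjI allI impI)
    fix S' t assume pos: "0 < g' (S', t)"
    show "S' \<in> cohesive E t"
      using pos consistent_cohesive[OF cons, of S' t] V S by (auto simp: g'_def split: if_splits)
    show "t \<in> {1..card (cands E)}"
      using pos consistent_rank[OF cons, of S' t] r by (auto simp: g'_def split: if_splits)
    show "g' (S', t) = delta_rem E g' S' t"
      unfolding rem[OF rank'[OF pos]]
      using pos consistent_eq[OF cons, of S' t] by (auto simp: g'_def split: if_splits)
  next
    fix S1 S2 t assume "0 < g' (S1, t)" "0 < g' (S2, t)" "S1 \<noteq> S2"
    then show "S1 \<inter> S2 = {}"
      using consistent_disjoint[OF cons, of S1 t S2] disj[OF S(1), of S1] disj[OF S(1), of S2]
      by (auto simp: g'_def split: if_splits)
  qed
  moreover have "covered E g' S' r" if "S' \<in> cohesive E r" "S' \<notin> \<V> \<or> S' \<inter> S \<noteq> {}" for S'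
  proof (cases "S' \<in> \<V>")
    case True
    then have "delta_rem E g' S' r \<le> g' (S, r)"
      using max by (simp add: rem) (simp add: g'_def)
    moreover have "S \<in> meeting E S'"
      using that True group by (auto simp: meeting_def)
    ultimately show ?thesis
      using r by (intro covered_if_delta_rem_le) auto
  next
    case False
    then show ?thesis
      using covered_mono[OF cov le] that by blast
  qed
  moreover have "\<forall>S1\<in>{S' \<in> \<V>. S' \<inter> S = {}}. \<forall>S2. 0 < g' (S2, r) \<longrightarrow> S1 \<inter> S2 = {}"
    using disj by (auto simp: g'_def)
  moreover have "\<forall>t\<in>{1..<r}. \<forall>S\<in>cohesive E t. covered E g' S t"
    using covered_mono[OF below le] by blast
  moreover have "{S' \<in> \<V>. S' \<inter> S = {}} \<subseteq> cohesive E r"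
    using V by blast
  ultimately show ?thesis
    unfolding g'_def[symmetric] invariant.simps using r rank' by blast
qed

lemma stage1_complete:
  assumes inv: "invariant E (Stage1 r \<V> g)" and exhausted: "\<not> (\<exists>S\<in>\<V>. 0 < delta_rem E g S r)"
    and "t \<in> {1..r}" "S \<in> cohesive E t"
  shows "covered E g S t"
proof (cases "t = r \<and> S \<in> \<V>")
  case True
  then show ?thesis
    using assms by (intro covered_if_delta_rem_eq_0) auto
next
  case False
  then show ?thesis
    using assms by (cases "t = r") auto
qed

lemma invariant_assign:
  assumes inv: "invariant E (Stage2 g ((S, r) # ps) F w)" and Th: "Th \<subseteq> F \<inter> agree_rounds E S r"
    "card Th = g (S, r)" "\<forall>j\<in>Th. v j \<in> (\<Inter>i\<in>S. top_set E i j r)"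
  shows "invariant E (Stage2 g ps (F - Th) (override_on w v Th))"
proof -
  obtain qs a where order: "is_stage2_order E g (qs @ (S, r) # ps)"
    and serves: "serves E g (set qs) (rounds E - F) w a" and F: "F \<subseteq> rounds E"
    using inv by auto
  have "(S, r) \<notin> set qs"
    using order by (auto simp: is_stage2_order_def)
  then have "serves E g (insert (S, r) (set qs)) (rounds E - F \<union> Th) (override_on w v Th)
               (override_on a (\<lambda>_. (S, r)) Th)"
    using serves Th by (intro serves_extend) auto
  moreover have "rounds E - F \<union> Th = rounds E - (F - Th)"
    using Th(1) F by auto
  ultimately have "is_stage2_order E g ((qs @ [(S, r)]) @ ps)
      \<and> serves E g (set (qs @ [(S, r)])) (rounds E - (F - Th)) (override_on w v Th)
          (override_on a (\<lambda>_. (S, r)) Th)"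
    using order by simp
  then show ?thesis
    using inv unfolding invariant.simps by blast
qed

lemma invariant_finish:
  assumes valid: "valid_election E" and inv: "invariant E (Stage2 g [] F w)"
    and W: "W \<in> sequences E" "\<forall>j\<in>rounds E - F. W j = w j"
  shows "invariant E (Output W)"
proof -
  obtain qs a where order: "is_stage2_order E g qs"
    and serves: "serves E g (set qs) (rounds E - F) w a"
    using inv by auto
  have "serves E g (supp g) (rounds E - F) W a"
    using serves W(2) stage2_order_set[OF _ order] inv by (simp add: serves_def)
  then have "fixed_rank_PJR E W"
    using valid inv by (intro fixed_rank_PJR_if_serves) auto
  with W(1) show ?thesis
    by simp
qed

lemma invariant_step:
  assumes valid: "valid_election E" and "rule_step E c c'" "invariant E c"
  shows "invariant E c'"
  using assms(2)
proof cases
  case (select S \<V> g r)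
  show ?thesis
    unfolding select(2) by (rule invariant_select) (use select assms(3) in blast)+
next
  case (next_rank \<V> g r)
  have inv: "invariant E (Stage1 r \<V> g)"
    using next_rank(1) assms(3) by simp
  have "covered E g S t" if "t \<in> {1..<r + 1}" "S \<in> cohesive E t" for t S
    using stage1_complete[OF inv next_rank(3)] that by simp
  moreover have "\<forall>S t. 0 < g (S, t) \<longrightarrow> t \<le> r + 1"
    using inv by (auto intro: le_SucI)
  \<comment> \<open>Nothing is selected at the new rank yet, so the disjointness clause for the
    refilled \<open>\<V>\<close> holds vacuously.\<close>
  moreover have "\<forall>S. \<not> 0 < g (S, r + 1)"
    using inv by (metis Suc_eq_plus1 Suc_n_not_le_n invariant.simps(1))
  ultimately show ?thesis
    using next_rank(2,4) inv by auto
next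
  case (start_stage2 \<V> g r ps)
  have inv: "invariant E (Stage1 r \<V> g)"
    using start_stage2(1) assms(3) by simp
  have "\<forall>t\<in>{1..card (cands E)}. \<forall>S\<in>cohesive E t. covered E g S t"
    using stage1_complete[OF inv start_stage2(3)] start_stage2(4) by simp
  moreover have "consistent E g"
    using inv by simp
  ultimately show ?thesis
    unfolding start_stage2(2) invariant.simps using start_stage2(5)
    by (intro conjI exI[of _ "[]"]) (simp_all add: serves_def)
next
  case (assign Th F S r g v ps w)
  then show ?thesis
    using invariant_assign assms(3) by metis
next
  case (finish W F w g)
  then show ?thesis
    using invariant_finish[OF valid] assms(3) by metis
qed

lemma invariant_reachable:
  assumes "valid_election E" "(rule_step E)\<^sup>*\<^sup>* (initial E) c"
  shows "invariant E c"
  using assms(2)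
  by (induction rule: rtranclp_induct) (auto intro: invariant_initial invariant_step assms(1))

section \<open>Progress\<close>

lemma stage2_order_exists:
  assumes "valid_election E"
  shows "\<exists>ps. is_stage2_order E g ps"
proof -
  let ?A = "{(S, r). voter_group E S \<and> r \<in> {1..card (cands E)} \<and> g (S, r) > 0}"
  let ?f = "\<lambda>(S, r). card (agree_rounds E S r)"
  have "finite ?A"
    by (rule finite_subset[of _ "Pow (voters E) \<times> {1..card (cands E)}"])
      (auto simp: voter_group_def)
  then obtain xs where "set xs = ?A" "distinct xs"
    using finite_distinct_list by blast
  then have "is_stage2_order E g (sort_key ?f xs)"
    unfolding is_stage2_order_def by (simp add: distinct_sort)
  then show ?thesis ..
qed

text \<open>Pairs processed earlier have at most \<open>card ?K\<close> agreement rounds by the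
  sorting, so the allocation bound applies with \<open>K = card ?K\<close>: the rounds used so far
  and the \<open>g (S, r)\<close> new ones number at most \<open>card ?K\<close>.\<close>

lemma progress_assign:
  assumes valid: "valid_election E" and inv: "invariant E (Stage2 g ((S, r) # ps) F w)"
  shows "\<exists>c'. rule_step E (Stage2 g ((S, r) # ps) F w) c'"
proof -
  let ?K = "agree_rounds E S r"
  obtain qs a where order: "is_stage2_order E g (qs @ (S, r) # ps)"
    and serves: "serves E g (set qs) (rounds E - F) w a" and cons: "consistent E g"
    using inv by auto
  have "sum g (insert (S, r) (set qs)) \<le> card ?K"
  proof (rule sum_allocation_le_agree_rounds[OF cons])
    fix S' t assume p: "(S', t) \<in> insert (S, r) (set qs)"
    then have "(S', t) \<in> set (qs @ (S, r) # ps)"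
      by auto
    then have "0 < g (S', t)"
      unfolding stage2_order_set[OF cons order] by (simp add: supp_def)
    moreover have "card (agree_rounds E S' t) \<le> card ?K"
      using p order by (auto simp: is_stage2_order_def sorted_append)
    ultimately show "0 < g (S', t) \<and> card (agree_rounds E S' t) \<le> card ?K"
      by simp
  qed (use valid in \<open>auto simp: valid_election_def\<close>)
  moreover have "(S, r) \<notin> set qs"
    using order by (auto simp: is_stage2_order_def)
  ultimately have "g (S, r) + card (rounds E - F) \<le> card ?K"
    using serves_card[OF serves] by simp
  \<comment> \<open>The worst case, in which every used round lies in \<open>?K\<close>, still
    leaves enough free rounds of agreement.\<close>
  also have "card ?K \<le> card (F \<inter> ?K \<union> (rounds E - F))"
    using inv finite_subset[of F "rounds E"]
    by (intro card_mono) (auto simp: agree_rounds_def)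
  also have "\<dots> \<le> card (F \<inter> ?K) + card (rounds E - F)"
    by (rule card_Un_le)
  finally have "g (S, r) \<le> card (F \<inter> ?K)"
    by simp
  then obtain Th where Th: "Th \<subseteq> F \<inter> ?K" "card Th = g (S, r)"
    using obtain_subset_with_card_n by metis
  have "\<forall>j\<in>Th. \<exists>x. x \<in> (\<Inter>i\<in>S. top_set E i j r)"
    using Th(1) unfolding agree_rounds_def agrees_def by blast
  then obtain v where "\<forall>j\<in>Th. v j \<in> (\<Inter>i\<in>S. top_set E i j r)"
    by metis
  with Th have "rule_step E (Stage2 g ((S, r) # ps) F w) (Stage2 g ps (F - Th) (override_on w v Th))"
    by (rule rule_step.assign)
  then show ?thesis ..
qed

text \<open>Only membership in \<open>sequences E\<close> is at stake: an assigned candidate lies in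
  the top set of some voter of a nonempty group, and free rounds receive an arbitrary candidate
  \<open>x\<close>.\<close>

lemma progress_finish:
  assumes valid: "valid_election E" and inv: "invariant E (Stage2 g [] F w)"
  shows "\<exists>c'. rule_step E (Stage2 g [] F w) c'"
proof -
  obtain qs a where order: "is_stage2_order E g qs"
    and serves: "serves E g (set qs) (rounds E - F) w a" and cons: "consistent E g"
    using inv by auto
  obtain x where x: "x \<in> cands E"
    using valid by (fastforce simp: valid_election_def)
  have "w j \<in> cands E" if j: "j \<in> rounds E - F" for j
  proof -
    obtain S t where St: "a j = (S, t)"
      by (cases "a j")
    have "(S, t) \<in> supp g" and w: "w j \<in> (\<Inter>i\<in>S. top_set E i j t)"
      using serves j St stage2_order_set[OF cons order] by (force simp: serves_def)+
    then obtain i where "i \<in> S" "i \<in> voters E"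
      using consistent_group[OF cons, of S t] by (auto simp: supp_def)
    then show ?thesis
      using w top_set_subset_cands[OF valid, of i j t] j by auto
  qed
  \<comment> \<open>\<open>sequences E\<close> is an extensional function space, hence the
    restriction.\<close>
  then have "restrict (\<lambda>j. if j \<in> F then x else w j) (rounds E) \<in> sequences E"
    using x by (auto simp: sequences_def)
  moreover have "\<forall>j\<in>rounds E - F. restrict (\<lambda>j. if j \<in> F then x else w j) (rounds E) j = w j"
    by auto
  ultimately show ?thesis
    using rule_step.finish by blast
qed

lemma progress_stage1:
  assumes valid: "valid_election E" and inv: "invariant E (Stage1 r \<V> g)"
  shows "\<exists>c'. rule_step E (Stage1 r \<V> g) c'"
proof (cases "\<exists>S\<in>\<V>. 0 < delta_rem E g S r")
  case True
  then obtain S0 where S0: "S0 \<in> \<V>" "0 < delta_rem E g S0 r"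
    by blast
  have "finite \<V>"
    using inv finite_subset[OF _ finite_cohesive] by auto
  then obtain S where S: "S \<in> \<V>" "\<forall>S'\<in>\<V>. delta_rem E g S' r \<le> delta_rem E g S r"
    using S0(1) obtains_MAX[of \<V> "\<lambda>S. delta_rem E g S r"]
    by (metis Max_ge empty_iff finite_imageI image_eqI)
  then have "0 < delta_rem E g S r"
    using S0 by (meson less_le_trans)
  then show ?thesis
    using rule_step.select[OF S(1)] S(2) by blast
next
  case False
  show ?thesis
  proof (cases "r < card (cands E)")
    case True
    then show ?thesis
      using rule_step.next_rank False by blast
  next
    case r: False
    then have "r = card (cands E)"
      using inv by auto
    moreover obtain ps where "is_stage2_order E g ps"
      using stage2_order_exists[OF valid] by blast
    ultimately have "rule_step E (Stage1 r \<V> g) (Stage2 g ps (rounds E) (\<lambda>_. undefined))"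
      using False by (intro rule_step.start_stage2)
    then show ?thesis ..
  qed
qed

lemma progress:
  assumes "valid_election E" "invariant E c" "\<nexists>c'. rule_step E c c'"
  shows "\<exists>W. c = Output W"
proof (cases c)
  case (Stage1 r \<V> g)
  then show ?thesis
    using progress_stage1 assms by blast
next
  case (Stage2 g ps F w)
  then show ?thesis
    using progress_assign progress_finish assms by (metis neq_Nil_conv surj_pair)
next
  case (Output W)
  then show ?thesis
    by blast
qed

section \<open>Termination\<close>

text \<open>Compared lexicographically: moving to the next rank may enlarge \<open>\<V>\<close>, but
  it lowers the second component.\<close>

fun config_measure :: "'c election \<Rightarrow> 'c config \<Rightarrow> nat \<times> nat \<times> nat" where
  "config_measure E (Stage1 r \<V> g) = (2, card (cands E) - r, card \<V>)"
| "config_measure E (Stage2 g ps F w) = (1, length ps, 0)"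
| "config_measure E (Output W) = (0, 0, 0)"

text \<open>The invariant is needed for selections: it makes \<open>\<V>\<close> finite and
  \<open>S\<close> nonempty, so that \<open>S\<close> meets itself and leaves
  \<open>\<V>\<close>.\<close>

lemma config_measure_decreases:
  assumes "rule_step E c c'" "invariant E c"
  shows "(config_measure E c', config_measure E c) \<in> less_than <*lex*> less_than <*lex*> less_than"
  using assms(1)
proof cases
  case (select S \<V> g r)
  have V: "\<V> \<subseteq> cohesive E r"
    using select(1) assms(2) by simp
  then have "S \<noteq> {}"
    using select(3) by (auto simp: cohesive_def voter_group_def)
  then have "{S' \<in> \<V>. S' \<inter> S = {}} \<subset> \<V>"
    using select(3) by auto
  then have "card {S' \<in> \<V>. S' \<inter> S = {}} < card \<V>"
    using finite_subset[OF V] by (intro psubset_card_mono) auto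
  then show ?thesis
    unfolding select(1,2) by simp
qed auto

lemma no_infinite_run:
  assumes "valid_election E"
  shows "\<nexists>c. c 0 = initial E \<and> (\<forall>i::nat. rule_step E (c i) (c (Suc i)))"
proof
  assume "\<exists>c. c 0 = initial E \<and> (\<forall>i::nat. rule_step E (c i) (c (Suc i)))"
  then obtain c where c: "c 0 = initial E" "\<And>i::nat. rule_step E (c i) (c (Suc i))"
    by blast
  have inv: "invariant E (c i)" for i
    by (induction i)
      (use c(1) invariant_initial[OF assms] invariant_step[OF assms c(2)] in simp_all)
  have "wf (less_than <*lex*> less_than <*lex*> less_than)"
    by (intro wf_lex_prod wf_less_than)
  moreover have "(config_measure E (c (Suc i)), config_measure E (c i))
      \<in> less_than <*lex*> less_than <*lex*> less_than" for i
    using config_measure_decreases[OF c(2) inv] .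
  ultimately show False
    unfolding wf_iff_no_infinite_down_chain
    by (elim notE) (intro exI[of _ "\<lambda>i. config_measure E (c i)"] allI)
qed

text \<open>The first two conjuncts say that every run ends in an output whatever choices are made;
  in particular the sets of rounds required in stage 2 always exist. The third is the guarantee for
  each possible output.\<close>

theorem theorem4p1:
  fixes E :: "'c election"
  assumes "valid_election E"
  shows "(\<nexists>c. c 0 = initial E \<and> (\<forall>i::nat. rule_step E (c i) (c (Suc i)))) \<and>
         (\<forall>c. (rule_step E)\<^sup>*\<^sup>* (initial E) c \<longrightarrow> (\<nexists>c'. rule_step E c c') \<longrightarrow> (\<exists>W. c = Output W)) \<and>
         (\<forall>W. (rule_step E)\<^sup>*\<^sup>* (initial E) (Output W) \<longrightarrow> W \<in> sequences E \<and> fixed_rank_PJR E W)"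
proof (intro conjI allI impI)
  show "\<nexists>c. c 0 = initial E \<and> (\<forall>i::nat. rule_step E (c i) (c (Suc i)))"
    using assms by (rule no_infinite_run)
next
  fix c assume "(rule_step E)\<^sup>*\<^sup>* (initial E) c" "\<nexists>c'. rule_step E c c'"
  then show "\<exists>W. c = Output W"
    using progress[OF assms] invariant_reachable[OF assms] by blast
next
  fix W assume "(rule_step E)\<^sup>*\<^sup>* (initial E) (Output W)"
  then have "invariant E (Output W)"
    by (rule invariant_reachable[OF assms])
  then show "W \<in> sequences E" "fixed_rank_PJR E W"
    by simp_all
qed

end
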